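(* For every integer $k \ge 4$ there exists a real number $\beta_k$ such that $R_k \le \beta_k < \alpha_k$, where $\alpha_k = \frac{k!}{k^{k-1}}$. Moreover, for $k=5$ and $k=6$ one has the explicit bounds $$R_5 < \beta_5 = 0.190825 < 0.192 = \alpha_5, \qquad R_6 < \beta_6 = 0.0922787 < \tfrac{5}{54} = \alpha_6 .$$
   Context: Let $k \ge 2$ and $n \ge 1$ be integers. A code of length $n$ over the alphabet $\{1,2,\dots,k\}$ is a subset $C \subseteq \{1,2,\dots,k\}^n$. Such a code $C$ is a $k$-hash code if for every set of $k$ distinct codewords $c^{(1)},\dots,c^{(k)} \in C$ there is a coordinate $j \in \{1,\dots,n\}$ with $\{c^{(1)}_j,\dots,c^{(k)}_j\} = \{1,2,\dots,k\}$ (i.e. the $k$ codewords take pairwise distinct values in coordinate $j$). The rate of $C$ is $\frac{\log_2 |C|}{n}$. For fixed $k$, $R_k$ denotes the supremum, as $n \to \infty$ (i.e. the limit superior as $n\to\infty$), of the rate of a largest $k$-hash code of length $n$. The quantity $\alpha_k = k!/k^{k-1}$ is the Fredman–Komlós bound, known to satisfy $R_k \le \alpha_k$. *)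

theory Defs
  imports Complex_Main "HOL-Library.Extended_Real"
begin

definition words :: "nat \<Rightarrow> nat \<Rightarrow> nat list set" where
  "words k n = {c. length c = n \<and> set c \<subseteq> {1..k}}"

definition is_hash_code :: "nat \<Rightarrow> nat \<Rightarrow> nat list set \<Rightarrow> bool" where
  "is_hash_code k n C \<longleftrightarrow> C \<subseteq> words k n \<and>
     (\<forall>S\<subseteq>C. card S = k \<longrightarrow> (\<exists>j<n. (\<lambda>c. c ! j) ` S = {1..k}))"

definition max_hash_size :: "nat \<Rightarrow> nat \<Rightarrow> nat" where
  "max_hash_size k n = Max {card C | C. is_hash_code k n C}"

definition hash_rate :: "nat \<Rightarrow> nat \<Rightarrow> real" where
  "hash_rate k n = log 2 (real (max_hash_size k n)) / real n"

definition R_hash :: "nat \<Rightarrow> ereal" where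
  "R_hash k = limsup (\<lambda>n. ereal (hash_rate k n))"

definition alpha_FK :: "nat \<Rightarrow> real" where
  "alpha_FK k = fact k / real k ^ (k - 1)"

end

theory Submission
  imports Defs "HOL-Analysis.Convex" "HOL-Real_Asymp.Real_Asymp"
begin

text \<open>
  Let \<open>C\<close> be a \<open>k\<close>-hash code of size \<open>N\<close>. Fix codewords \<open>x\<^sub>1, \<dots>, x\<^sub>k\<^sub>-\<^sub>2\<close>; the remaining codewords are
  separated by \<open>n\<close> bipartite graphs, one for each coordinate, so Hansel's lemma bounds \<open>log\<^sub>2 N\<close>
  by the sum of their densities. Averaging over uniform \<open>x\<^sub>i\<close> gives the Fredman--Komlos bound
  \<open>\<alpha>\<^sub>k\<close>. To improve it, take \<open>r\<close> with \<open>k\<^sup>r\<close> slightly below \<open>N\<close>, choose \<open>x\<^sub>1\<close> uniformly, \<open>x\<^sub>2\<close>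
  uniformly among the codewords with the same prefix of length \<open>r\<close>, and all other \<open>x\<^sub>i\<close>
  uniformly. The first \<open>r\<close> coordinates now contribute nothing, while every other coordinate still
  contributes at most \<open>\<alpha>\<^sub>k\<close>, whatever its distribution \<open>f\<close> is: the contribution is an average of
  the values of the Hessian of the elementary symmetric polynomial \<open>e\<^sub>k\<^sub>-\<^sub>1\<close> at \<open>f\<close> on distributions
  with mean \<open>f\<close>, this Hessian is Lorentzian, and the reverse Cauchy--Schwarz inequality together
  with the inequalities of Chebyshev and Maclaurin bounds the average by \<open>\<alpha>\<^sub>k\<close>. In the limit,
  \<open>R\<^sub>k \<le> \<alpha>\<^sub>k (1 - R\<^sub>k / log\<^sub>2 k)\<close>.
\<close>

section \<open>Hansel's lemma\<close>

text \<open>For each \<open>i\<close>, delete \<open>A i\<close> or \<open>B i\<close> from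
  \<open>V\<close> by a fair coin. A vertex survives with probability equal to its summand, and two
  survivors would contradict separation, so the expected number of survivors is at most 1. The
  induction conditions on one coin.\<close>

lemma hansel_weight:
  fixes A B :: "'i \<Rightarrow> 'a set"
  assumes "finite I" "finite V"
    and "\<And>i. i \<in> I \<Longrightarrow> A i \<inter> B i = {}"
    and "\<And>y z. y \<in> V \<Longrightarrow> z \<in> V \<Longrightarrow> y \<noteq> z \<Longrightarrow>
           \<exists>i\<in>I. (y \<in> A i \<and> z \<in> B i) \<or> (z \<in> A i \<and> y \<in> B i)"
  shows "(\<Sum>v\<in>V. (1/2) ^ card {i\<in>I. v \<in> A i \<union> B i}) \<le> (1::real)"
  using assms
proof (induction I arbitrary: V rule: finite_induct)
  case empty
  have "\<forall>y\<in>V. \<forall>z\<in>V. y = z" using empty.prems(3) by blast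
  then have "card V \<le> 1" using empty.prems(1) by (simp add: card_le_Suc0_iff_eq)
  then show ?case by simp
next
  case (insert i I)
  define d where "d v = card {j\<in>I. v \<in> A j \<union> B j}" for v
  have d_insert: "card {j\<in>insert i I. v \<in> A j \<union> B j} = (if v \<in> A i \<union> B i then Suc (d v) else d v)" for v
  proof -
    have "{j\<in>insert i I. v \<in> A j \<union> B j} =
      (if v \<in> A i \<union> B i then insert i {j\<in>I. v \<in> A j \<union> B j} else {j\<in>I. v \<in> A j \<union> B j})"
      by auto
    then show ?thesis using insert.hyps by (simp add: d_def)
  qed
  have "(\<Sum>v\<in>V - B i. (1/2) ^ d v) \<le> (1::real)" unfolding d_def
  proof (rule insert.IH)
    fix y z assume "y \<in> V - B i" "z \<in> V - B i" "y \<noteq> z"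
    then show "\<exists>j\<in>I. (y \<in> A j \<and> z \<in> B j) \<or> (z \<in> A j \<and> y \<in> B j)"
      using insert.prems(3)[of y z] by blast
  qed (use insert.prems in auto)
  moreover have "(\<Sum>v\<in>V - A i. (1/2) ^ d v) \<le> (1::real)" unfolding d_def
  proof (rule insert.IH)
    fix y z assume "y \<in> V - A i" "z \<in> V - A i" "y \<noteq> z"
    then show "\<exists>j\<in>I. (y \<in> A j \<and> z \<in> B j) \<or> (z \<in> A j \<and> y \<in> B j)"
      using insert.prems(3)[of y z] by blast
  qed (use insert.prems in auto)
  \<comment> \<open>A vertex outside \<open>A i\<close> and \<open>B i\<close> is counted in both
    sums on the right; a vertex in one of them is counted once, which accounts for its extra factor
    1/2.\<close>
  moreover have "(\<Sum>v\<in>V. (1/2) ^ (if v \<in> A i \<union> B i then Suc (d v) else d v)) =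
      ((\<Sum>v\<in>V - B i. (1/2) ^ d v) + (\<Sum>v\<in>V - A i. (1/2) ^ d v)) / (2::real)"
  proof -
    have "(\<Sum>v\<in>V - X. (1/2) ^ d v) = (\<Sum>v\<in>V. if v \<in> X then 0 else (1/2::real) ^ d v)" for X
      using insert.prems(1) by (intro sum.mono_neutral_cong_left) auto
    moreover have "A i \<inter> B i = {}" using insert.prems by simp
    ultimately show ?thesis
      by (auto simp: sum.distrib[symmetric] sum_divide_distrib intro!: sum.cong)
  qed
  ultimately show ?case unfolding d_insert by simp
qed

lemma hansel:
  fixes A B :: "'i \<Rightarrow> 'a set"
  assumes "finite I" "finite V" "V \<noteq> {}"
    and "\<And>i. i \<in> I \<Longrightarrow> A i \<inter> B i = {}"
    and "\<And>y z. y \<in> V \<Longrightarrow> z \<in> V \<Longrightarrow> y \<noteq> z \<Longrightarrow>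
           \<exists>i\<in>I. (y \<in> A i \<and> z \<in> B i) \<or> (z \<in> A i \<and> y \<in> B i)"
  shows "log 2 (card V) \<le> (\<Sum>i\<in>I. real (card (V \<inter> (A i \<union> B i)))) / card V"
proof -
  define d where "d v = card {i\<in>I. v \<in> A i \<union> B i}" for v
  define m where "m = real (card V)"
  define \<mu> where "\<mu> = (\<Sum>v\<in>V. real (d v)) / m"
  have m: "m > 0" using assms by (simp add: m_def card_gt_0_iff)
  have "(\<Sum>v\<in>V. real (d v)) = (\<Sum>v\<in>V. \<Sum>i\<in>I. if v \<in> A i \<union> B i then 1 else 0)"
    using assms(1) by (simp add: d_def sum.If_cases Int_def)
  also have "\<dots> = (\<Sum>i\<in>I. real (card (V \<inter> (A i \<union> B i))))"
    using assms(2) by (subst sum.swap) (simp add: sum.If_cases Un_def)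
  finally have deg: "\<mu> = (\<Sum>i\<in>I. real (card (V \<inter> (A i \<union> B i)))) / m"
    by (simp add: \<mu>_def)
  \<comment> \<open>The tangent at \<mu> to the convex function \<open>2 powr (-d)\<close>. Since
    \<mu> is the mean degree, the linear terms cancel when summed over \<open>V\<close>; this is
    Jensen's inequality.\<close>
  have tangent: "2 powr (-\<mu>) * (1 - ln 2 * (d v - \<mu>)) \<le> (1/2) ^ d v" for v
  proof -
    have "(1/2::real) ^ d v = 2 powr (- real (d v))"
      by (simp add: powr_minus_divide powr_realpow power_one_over)
    also have "\<dots> = 2 powr (-\<mu>) * exp (- ln 2 * (d v - \<mu>))"
      by (simp add: powr_def exp_add[symmetric] algebra_simps)
    finally show ?thesis
      using exp_ge_add_one_self[of "- ln 2 * (d v - \<mu>)"] by simp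
  qed
  have "2 powr (-\<mu>) * m = (\<Sum>v\<in>V. 2 powr (-\<mu>) * (1 - ln 2 * (d v - \<mu>)))"
  proof -
    have "(\<Sum>v\<in>V. 1 - ln 2 * (d v - \<mu>)) = m - ln 2 * ((\<Sum>v\<in>V. real (d v)) - m * \<mu>)"
      by (simp add: sum_subtractf sum_distrib_left[symmetric] m_def)
    also have "\<dots> = m" using m by (simp add: \<mu>_def)
    finally show ?thesis by (simp add: sum_distrib_left[symmetric])
  qed
  also have "\<dots> \<le> (\<Sum>v\<in>V. (1/2) ^ d v)" by (intro sum_mono tangent)
  also have "\<dots> \<le> 1" unfolding d_def by (rule hansel_weight) (use assms in auto)
  finally have "m \<le> 2 powr \<mu>" by (simp add: powr_minus field_simps)
  then have "log 2 m \<le> \<mu>" using m by (simp add: log_le_iff)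
  then show ?thesis by (simp add: deg m_def)
qed

section \<open>Elementary symmetric polynomials\<close>

text \<open>Chebyshev's sum inequality, by expanding the double sum of
  \<open>(x a - x b) * (y a - y b)\<close>.\<close>

lemma oppositely_ordered_sum_le:
  fixes x y :: "'a \<Rightarrow> real"
  assumes "\<And>a b. a \<in> S \<Longrightarrow> b \<in> S \<Longrightarrow> (x a - x b) * (y a - y b) \<le> 0"
  shows "card S * (\<Sum>a\<in>S. x a * y a) \<le> sum x S * sum y S"
proof -
  have "(\<Sum>a\<in>S. \<Sum>b\<in>S. (x a - x b) * (y a - y b)) \<le> 0"
    by (intro sum_nonpos assms)
  moreover have "(\<Sum>a\<in>S. \<Sum>b\<in>S. (x a - x b) * (y a - y b)) =
      2 * (card S * (\<Sum>a\<in>S. x a * y a)) - 2 * (sum x S * sum y S)"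
    by (simp add: left_diff_distrib right_diff_distrib sum_subtractf sum_distrib_left[symmetric]
          sum_distrib_right[symmetric] mult.commute[of "sum _ S" "real _"])
  ultimately show ?thesis by simp
qed

text \<open>The sum over ordered tuples, that is, \<open>j!\<close> times the elementary symmetric polynomial \<open>e\<^sub>j\<close> of \<open>f\<close> on \<open>S\<close>.\<close>

primrec distinct_sum :: "('a \<Rightarrow> 'b::comm_semiring_1) \<Rightarrow> nat \<Rightarrow> 'a set \<Rightarrow> 'b" where
  "distinct_sum f 0 S = 1"
| "distinct_sum f (Suc j) S = (\<Sum>a\<in>S. f a * distinct_sum f j (S - {a}))"

lemma distinct_sum_nonneg:
  fixes f :: "'a \<Rightarrow> real"
  assumes "\<And>a. a \<in> S \<Longrightarrow> f a \<ge> 0"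
  shows "distinct_sum f j S \<ge> 0"
  using assms
proof (induction j arbitrary: S)
  case (Suc j)
  then have "distinct_sum f j (S - {a}) \<ge> 0" for a by blast
  with Suc.prems show ?case by (auto intro!: sum_nonneg mult_nonneg_nonneg)
qed simp

lemma distinct_sum_scale:
  "distinct_sum (\<lambda>a. c * f a) j S = c ^ j * distinct_sum f j S"
  by (induction j arbitrary: S) (simp_all add: sum_distrib_left mult_ac)

text \<open>In an ordered tuple with distinct entries, \<open>b\<close> is either absent or sits in
  one of \<open>Suc j\<close> positions.\<close>

lemma distinct_sum_insert:
  assumes "finite S" "b \<notin> S"
  shows "distinct_sum f (Suc j) (insert b S) =
           distinct_sum f (Suc j) S + of_nat (Suc j) * f b * distinct_sum f j S"
  using assms
proof (induction j arbitrary: S)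
  case 0
  then show ?case by (simp add: add.commute)
next
  case (Suc j)
  have "(\<Sum>a\<in>S. f a * distinct_sum f (Suc j) (insert b S - {a})) =
        (\<Sum>a\<in>S. f a * (distinct_sum f (Suc j) (S - {a}) + of_nat (Suc j) * f b * distinct_sum f j (S - {a})))"
  proof (intro sum.cong refl arg_cong2[of _ _ _ _ "(*)"])
    fix a assume "a \<in> S"
    then have "insert b S - {a} = insert b (S - {a})" using Suc.prems by auto
    then show "distinct_sum f (Suc j) (insert b S - {a}) = 
      distinct_sum f (Suc j) (S - {a}) + of_nat (Suc j) * f b * distinct_sum f j (S - {a})"
      using Suc.IH[of "S - {a}"] Suc.prems by simp
  qed
  also have "\<dots> = distinct_sum f (Suc (Suc j)) S + of_nat (Suc j) * f b * distinct_sum f (Suc j) S"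
    by (simp add: distrib_left sum.distrib sum_distrib_left algebra_simps)
  finally have *: "(\<Sum>a\<in>S. f a * distinct_sum f (Suc j) (insert b S - {a})) = \<dots>" .
  have "distinct_sum f (Suc (Suc j)) (insert b S) =
      f b * distinct_sum f (Suc j) S + (\<Sum>a\<in>S. f a * distinct_sum f (Suc j) (insert b S - {a}))"
    using Suc.prems by (simp del: distinct_sum.simps(2) add: distinct_sum.simps(2)[of _ "Suc j"])
  then show ?case unfolding * by (simp add: algebra_simps del: distinct_sum.simps)
qed

lemma distinct_sum_remove:
  assumes "finite S" "b \<in> S"
  shows "distinct_sum f j S =
           distinct_sum f j (S - {b}) + of_nat j * f b * distinct_sum f (j - 1) (S - {b})"
  using distinct_sum_insert[of "S - {b}" b f] assms
  by (cases j) (auto simp: insert_absorb simp del: distinct_sum.simps(2))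

text \<open>One step of Maclaurin's inequality. The larger \<open>f a\<close> is, the smaller is the
  distinct sum over \<open>S - {a}\<close>, so Chebyshev's inequality applies; and a tuple of
  \<open>j\<close> distinct elements is avoided by \<open>card S - j\<close> choices of
  \<open>a\<close>.\<close>

lemma distinct_sum_Suc_le:
  fixes f :: "'a \<Rightarrow> real"
  assumes S: "finite S" and nn: "\<And>a. a \<in> S \<Longrightarrow> f a \<ge> 0" and one: "sum f S = 1"
  shows "card S * distinct_sum f (Suc j) S \<le> (real (card S) - j) * distinct_sum f j S"
proof -
  define y where "y a = distinct_sum f j (S - {a})" for a
  have "(f a - f b) * (y a - y b) \<le> 0" if ab: "a \<in> S" "b \<in> S" for a b
  proof (cases "a = b")
    case False
    have "y a - y b = real j * (f b - f a) * distinct_sum f (j - 1) (S - {a} - {b})"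
      using distinct_sum_remove[of "S - {a}" b f j] distinct_sum_remove[of "S - {b}" a f j] S ab False
      by (simp add: y_def algebra_simps Diff_insert2[symmetric] insert_commute)
    then have "(f a - f b) * (y a - y b) =
        - (real j * distinct_sum f (j - 1) (S - {a} - {b}) * (f a - f b)\<^sup>2)"
      by (simp only:) (simp add: power2_eq_square algebra_simps)
    then show ?thesis
      using nn by (auto intro!: mult_nonneg_nonneg distinct_sum_nonneg)
  qed simp
  then have "card S * (\<Sum>a\<in>S. f a * y a) \<le> sum y S"
    using oppositely_ordered_sum_le[of S f y] one by simp
  moreover have "sum y S = (real (card S) - j) * distinct_sum f j S"
  proof -
    have "distinct_sum f j S = y a + real j * (f a * distinct_sum f (j - 1) (S - {a}))" if "a \<in> S" for a
      using distinct_sum_remove[OF S that, of f j] by (simp only: mult.assoc y_def)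
    then have "(\<Sum>a\<in>S. distinct_sum f j S) =
        (\<Sum>a\<in>S. y a + real j * (f a * distinct_sum f (j - 1) (S - {a})))"
      by (rule sum.cong[OF refl])
    also have "\<dots> = sum y S + real j * distinct_sum f j S"
      by (cases j) (simp_all add: sum.distrib sum_distrib_left)
    finally show ?thesis by (simp add: algebra_simps del: distinct_sum.simps)
  qed
  ultimately show ?thesis by (simp add: y_def)
qed

text \<open>The right side is the value at the uniform distribution; each step of the iteration
  contributes one factor \<open>(card S - j) / card S\<close>.\<close>

lemma distinct_sum_maclaurin:
  fixes f :: "'a \<Rightarrow> real"
  assumes S: "finite S" and nn: "\<And>a. a \<in> S \<Longrightarrow> f a \<ge> 0" and one: "sum f S = 1"
    and "j \<le> card S"
  shows "distinct_sum f j S \<le> fact (card S) / (fact (card S - j) * real (card S) ^ j)"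
  using \<open>j \<le> card S\<close>
proof (induction j)
  case (Suc j)
  define k where "k = card S"
  have k: "k > 0" "j < k" using Suc.prems by (auto simp: k_def)
  have "real k * distinct_sum f (Suc j) S \<le> (real k - j) * distinct_sum f j S"
    unfolding k_def by (rule distinct_sum_Suc_le) (use assms in auto)
  also have "\<dots> \<le> (real k - j) * (fact k / (fact (k - j) * real k ^ j))"
    using Suc k by (intro mult_left_mono) (auto simp: k_def)
  also have "fact (k - j) = (real k - j) * fact (k - Suc j)"
    using k by (subst fact_reduce) (auto simp: of_nat_diff)
  also have "(real k - j) * (fact k / ((real k - j) * fact (k - Suc j) * real k ^ j)) = 
     real k * (fact k / (fact (k - Suc j) * real k ^ Suc j))"
    using k by (simp add: field_simps)
  finally show ?case
    using k by (simp only: k_def mult_le_cancel_left_pos of_nat_0_less_iff)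
qed (use assms in auto)

lemma distinct_sum_eq_0:
  assumes "finite S" "card S < j"
  shows "distinct_sum f j S = 0"
  using assms
proof (induction j arbitrary: S)
  case (Suc j)
  have "distinct_sum f j (S - {a}) = 0" if "a \<in> S" for a
    using that Suc.prems card_gt_0_iff[of S] by (intro Suc.IH) auto
  then show ?case by simp
qed simp

lemma distinct_sum_card:
  assumes "finite S"
  shows "distinct_sum f (card S) S = fact (card S) * prod f S"
  using assms
proof (induction S rule: finite_induct)
  case (insert b S)
  then have "distinct_sum f (card (insert b S)) (insert b S) =
      of_nat (Suc (card S)) * f b * (fact (card S) * prod f S)"
    using distinct_sum_insert[of S b f "card S"] distinct_sum_eq_0[of S "Suc (card S)" f]
    by (simp del: distinct_sum.simps)
  then show ?case using insert.hyps by (simp add: algebra_simps)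
qed simp

text \<open>A tuple of this length omits exactly one element \<open>a\<close>; its product is
  \<open>prod f S / f a\<close>, in \<open>fact j\<close> orders.\<close>

lemma distinct_sum_card_minus_1:
  fixes f :: "'a \<Rightarrow> real"
  assumes "finite S" "\<And>a. a \<in> S \<Longrightarrow> f a > 0" "card S = Suc j"
  shows "distinct_sum f j S = fact j * prod f S * (\<Sum>a\<in>S. 1 / f a)"
  using assms
proof (induction S arbitrary: j rule: finite_induct)
  case (insert b S)
  then have card: "card S = j" and pos: "f b > 0" by auto
  show ?case
  proof (cases j)
    case 0
    then show ?thesis using insert card by simp
  next
    case (Suc i)
    then have "distinct_sum f i S = fact i * prod f S * (\<Sum>a\<in>S. 1 / f a)"
      using insert card by auto
    moreover have "distinct_sum f j (insert b S) = distinct_sum f j S + real (Suc i) * f b * distinct_sum f i S"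
      using insert.hyps Suc distinct_sum_insert[of S b f i] by simp
    moreover have "distinct_sum f j S = fact j * prod f S"
      using distinct_sum_card[of S f] insert.hyps card by simp
    moreover have "fact j = real (Suc i) * fact i" using Suc by simp
    ultimately have "distinct_sum f j (insert b S) = fact j * prod f S * (1 + f b * (\<Sum>a\<in>S. 1 / f a))"
      by (simp add: algebra_simps del: of_nat_Suc)
    also have "1 + f b * (\<Sum>a\<in>S. 1 / f a) = f b * (\<Sum>a\<in>insert b S. 1 / f a)"
      using pos insert.hyps by (simp add: distrib_left)
    finally show ?thesis using insert.hyps by (simp add: mult_ac)
  qed
qed simp

text \<open>Now two elements are omitted. The difference on the right is the sum of
  \<open>1 / (f a * f b)\<close> over ordered pairs of distinct elements, hence the factor
  2.\<close>

lemma distinct_sum_card_minus_2: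
  fixes f :: "'a \<Rightarrow> real"
  assumes "finite S" "\<And>a. a \<in> S \<Longrightarrow> f a > 0" "card S = Suc (Suc j)"
  shows "2 * distinct_sum f j S = fact j * prod f S * ((\<Sum>a\<in>S. 1 / f a)\<^sup>2 - (\<Sum>a\<in>S. (1 / f a)\<^sup>2))"
  using assms
proof (induction S arbitrary: j rule: finite_induct)
  case (insert b S)
  then have card: "card S = Suc j" and pos: "f b > 0" by auto
  define G H where "G = (\<Sum>a\<in>S. 1 / f a)" and "H = (\<Sum>a\<in>S. (1 / f a)\<^sup>2)"
  have eq: "prod f (insert b S) = f b * prod f S" "(\<Sum>a\<in>insert b S. 1 / f a) = 1 / f b + G"
    "(\<Sum>a\<in>insert b S. (1 / f a)\<^sup>2) = (1 / f b)\<^sup>2 + H"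
    using insert.hyps by (auto simp: G_def H_def)
  have lin: "distinct_sum f j S = fact j * prod f S * G"
    unfolding G_def using insert card by (intro distinct_sum_card_minus_1) auto
  show ?case
  proof (cases j)
    case 0
    then obtain c where "S = {c}" using card card_1_singletonE by auto
    then have *: "prod f S = f c" "G = 1 / f c" "H = (1 / f c)\<^sup>2" "f c > 0"
      using insert.prems by (auto simp: G_def H_def)
    show ?thesis unfolding eq *(1-3) using 0 pos *(4) by (simp add: field_simps power2_eq_square)
  next
    case (Suc i)
    then have "2 * distinct_sum f i S = fact i * prod f S * (G\<^sup>2 - H)"
      unfolding G_def H_def using insert card by auto
    moreover have "fact j = real (Suc i) * fact i" using Suc by simp
    moreover have "2 * distinct_sum f j (insert b S) =
        2 * distinct_sum f j S + real (Suc i) * f b * (2 * distinct_sum f i S)"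
      using insert.hyps Suc distinct_sum_insert[of S b f i] by simp
    ultimately have "2 * distinct_sum f j (insert b S) = fact j * prod f S * (2 * G + f b * (G\<^sup>2 - H))"
      using lin by (simp only:) (simp add: algebra_simps)
    also have "2 * G + f b * (G\<^sup>2 - H) = f b * ((1 / f b + G)\<^sup>2 - ((1 / f b)\<^sup>2 + H))"
      using pos by (simp add: field_simps power2_eq_square)
    finally show ?thesis unfolding eq by (simp add: mult_ac)
  qed
qed simp

section \<open>The contribution of one coordinate\<close>

text \<open>This is \<open>lorentzian_form_le\<close> in the case of mean zero. The weighted squares
  are controlled by the product of the extreme values of \<open>B\<close>, after which the
  Cauchy-Schwarz inequality for \<open>card S - 1\<close> numbers suffices.\<close>

lemma weighted_deviation_bound:
  fixes q B :: "'a \<Rightarrow> real"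
  assumes S: "finite S" and q0: "\<And>a. a \<in> S \<Longrightarrow> q a \<ge> 0" and q1: "sum q S = 1"
    and mean: "(\<Sum>a\<in>S. q a * B a) = 0"
  shows "2 * (real (card S) - 1) * (\<Sum>a\<in>S. q a * (B a)\<^sup>2) + (sum B S)\<^sup>2
           \<le> (real (card S) - 1) * (\<Sum>a\<in>S. (B a)\<^sup>2)"
proof -
  have ne: "S \<noteq> {}" using q1 by auto
  have "Max (B ` S) \<in> B ` S" "Min (B ` S) \<in> B ` S" using S ne by simp_all
  then obtain i j where i: "i \<in> S" "B i = Max (B ` S)" and j: "j \<in> S" "B j = Min (B ` S)" by auto
  have le_i: "B a \<le> B i" and ge_j: "B j \<le> B a" if "a \<in> S" for a
    unfolding i j using that S by simp_all
  show ?thesis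
  \<comment> \<open>A constant function of mean zero vanishes; otherwise the extremes are attained
    at two different elements, which can be merged.\<close>
  proof (cases "B i = B j")
    case True
    then have "B a = B i" if "a \<in> S" for a using le_i[OF that] ge_j[OF that] by simp
    moreover from this have "(\<Sum>a\<in>S. q a * B a) = (\<Sum>a\<in>S. q a * B i)" by simp
    then have "B i = 0" using mean q1 by (simp add: sum_distrib_right[symmetric])
    ultimately show ?thesis by simp
  next
    case False
    then have ij: "i \<noteq> j" by auto
    \<comment> \<open>Merging the two extreme entries absorbs the variance term, and leaves only \<open>card S - 1\<close> entries.\<close>
    define c where "c a = (if a = i then B i + B j else B a)" for a
    \<comment> \<open>Bhatia--Davis: the variance is at most \<open>(max - mean) (mean - min)\<close>.\<close>
    have "0 \<le> (\<Sum>a\<in>S. q a * ((B i - B a) * (B a - B j)))"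
      using le_i ge_j q0 by (intro sum_nonneg mult_nonneg_nonneg) auto
    also have "\<dots> = (B i + B j) * (\<Sum>a\<in>S. q a * B a) - (\<Sum>a\<in>S. q a * (B a)\<^sup>2) - B i * B j * sum q S"
      by (simp add: algebra_simps sum.distrib sum_subtractf sum_distrib_left power2_eq_square)
    finally have var: "(\<Sum>a\<in>S. q a * (B a)\<^sup>2) \<le> - B i * B j" using mean q1 by simp
    have iS: "i \<in> S - {j}" using i ij by auto
    have sums: "sum F S = F i + F j + sum F (S - {j} - {i})" for F :: "'a \<Rightarrow> real"
      using S i j ij by (simp add: sum.remove[of S j] sum.remove[of "S - {j}" i])
    have sumc: "(\<Sum>a\<in>S - {j}. F (c a)) = F (B i + B j) + (\<Sum>a\<in>S - {j} - {i}. F (B a))" for F :: "real \<Rightarrow> real"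
      using S iS by (simp add: sum.remove[of "S - {j}" i] c_def)
    have "(sum B S)\<^sup>2 = (sum c (S - {j}))\<^sup>2"
      using sums[of B] sumc[of "\<lambda>x. x"] by simp
    also have "\<dots> \<le> card (S - {j}) * (\<Sum>a\<in>S - {j}. (c a)\<^sup>2)"
      using sum_squared_le_sum_of_squares[of c "S - {j}"] S by (simp add: mult.commute)
    also have "\<dots> = (real (card S) - 1) * ((\<Sum>a\<in>S. (B a)\<^sup>2) + 2 * (B i * B j))"
    proof -
      have "card S \<ge> 1" using S ne by (simp add: Suc_leI card_gt_0_iff)
      then have "real (card (S - {j})) = real (card S) - 1" using j S by (simp add: of_nat_diff)
      moreover have "(\<Sum>a\<in>S - {j}. (c a)\<^sup>2) = (\<Sum>a\<in>S. (B a)\<^sup>2) + 2 * (B i * B j)"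
        using sums[of "\<lambda>a. (B a)\<^sup>2"] sumc[of "\<lambda>x. x\<^sup>2"]
        by (simp add: power2_eq_square algebra_simps)
      ultimately show ?thesis by simp
    qed
    also have "\<dots> \<le> (real (card S) - 1) * ((\<Sum>a\<in>S. (B a)\<^sup>2) - 2 * (\<Sum>a\<in>S. q a * (B a)\<^sup>2))"
    proof -
      have "card S \<ge> 1" using S ne by (simp add: Suc_leI card_gt_0_iff)
      then show ?thesis using var by (intro mult_left_mono) auto
    qed
    finally show ?thesis by (simp add: algebra_simps)
  qed
qed

text \<open>The reverse Cauchy--Schwarz inequality for a form of Lorentzian signature, tested against constant \<open>u\<close>.\<close>

lemma lorentzian_form_le:
  fixes q u :: "'a \<Rightarrow> real"
  assumes S: "finite S" and q0: "\<And>a. a \<in> S \<Longrightarrow> q a \<ge> 0" and q1: "sum q S = 1"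
  shows "(real (card S) - 1) * (\<Sum>a\<in>S. \<Sum>b\<in>S - {a}. u a * u b * (1 - q a - q b))
           \<le> (real (card S) - 2) * (\<Sum>a\<in>S. u a * (1 - q a))\<^sup>2"
proof -
  define k where "k = real (card S)"
  define m U where "m = (\<Sum>a\<in>S. q a * u a)" and "U = sum u S"
  define S2 S2q where "S2 = (\<Sum>a\<in>S. (u a)\<^sup>2)" and "S2q = (\<Sum>a\<in>S. q a * (u a)\<^sup>2)"
  \<comment> \<open>The difference of the two sides of the claim does not change when a constant is
    added to \<open>u\<close>, so \<open>u\<close> may be replaced by its deviation from the
    \<open>q\<close>-mean.\<close>
  define B where "B a = u a - m" for a
  have mean: "(\<Sum>a\<in>S. q a * B a) = 0"
    using q1 by (simp add: B_def right_diff_distrib sum_subtractf sum_distrib_right[symmetric] m_def)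
  have B1: "sum B S = U - k * m" by (simp add: B_def sum_subtractf U_def k_def)
  have B2: "(\<Sum>a\<in>S. (B a)\<^sup>2) = S2 - 2 * m * U + k * m\<^sup>2"
    by (simp add: B_def power2_diff sum.distrib sum_subtractf S2_def U_def k_def
        sum_distrib_left[symmetric] sum_distrib_right[symmetric] mult_ac)
  have "(\<Sum>a\<in>S. q a * (B a)\<^sup>2) = (\<Sum>a\<in>S. q a * (u a)\<^sup>2 - 2 * m * (q a * u a) + m\<^sup>2 * q a)"
    by (intro sum.cong refl) (simp add: B_def power2_eq_square algebra_simps)
  also have "\<dots> = S2q - 2 * m * m + m\<^sup>2 * sum q S"
    by (simp only: sum.distrib sum_subtractf sum_distrib_left[symmetric] S2q_def m_def)
  finally have "(\<Sum>a\<in>S. q a * (B a)\<^sup>2) = S2q - 2 * m * m + m\<^sup>2 * sum q S" .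
  then have Bq: "(\<Sum>a\<in>S. q a * (B a)\<^sup>2) = S2q - m\<^sup>2" using q1 by (simp add: power2_eq_square)
  have lin: "(\<Sum>a\<in>S. u a * (1 - q a)) = U - m"
    by (simp add: right_diff_distrib sum_subtractf U_def m_def mult.commute)
  have "(\<Sum>a\<in>S. \<Sum>b\<in>S - {a}. u a * u b * (1 - q a - q b))
     = (\<Sum>a\<in>S. (\<Sum>b\<in>S. u a * u b * (1 - q a - q b)) - (u a)\<^sup>2 * (1 - 2 * q a))"
    using S by (intro sum.cong refl) (simp add: sum_diff1 power2_eq_square)
  also have "\<dots> = (\<Sum>a\<in>S. U * u a - U * (q a * u a) - m * u a - (u a)\<^sup>2 + 2 * (q a * (u a)\<^sup>2))"
  proof (intro sum.cong refl)
    fix a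
    have "(\<Sum>b\<in>S. u a * u b * (1 - q a - q b)) = (\<Sum>b\<in>S. (u a * (1 - q a)) * u b - u a * (q b * u b))"
      by (intro sum.cong refl) (simp add: algebra_simps)
    also have "\<dots> = (u a * (1 - q a)) * U - u a * m"
      by (simp only: sum_subtractf sum_distrib_left[symmetric] U_def m_def)
    finally show "(\<Sum>b\<in>S. u a * u b * (1 - q a - q b)) - (u a)\<^sup>2 * (1 - 2 * q a) =
        U * u a - U * (q a * u a) - m * u a - (u a)\<^sup>2 + 2 * (q a * (u a)\<^sup>2)"
      by (simp add: algebra_simps)
  qed
  also have "\<dots> = U * U - U * m - m * U - S2 + 2 * S2q"
    by (simp only: sum.distrib sum_subtractf sum_distrib_left[symmetric] U_def m_def S2_def S2q_def)
  also have "\<dots> = U\<^sup>2 - 2 * U * m - S2 + 2 * S2q"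
    by (simp add: power2_eq_square)
  finally have form: "(\<Sum>a\<in>S. \<Sum>b\<in>S - {a}. u a * u b * (1 - q a - q b)) = \<dots>" .
  have "2 * (k - 1) * (S2q - m\<^sup>2) + (U - k * m)\<^sup>2 \<le> (k - 1) * (S2 - 2 * m * U + k * m\<^sup>2)"
    using weighted_deviation_bound[OF S q0 q1 mean] unfolding B1 B2 Bq k_def by simp
  then have "(k - 1) * (U\<^sup>2 - 2 * U * m - S2 + 2 * S2q) \<le> (k - 2) * (U - m)\<^sup>2"
    by (simp add: power2_eq_square algebra_simps)
  then show ?thesis unfolding form lin k_def .
qed

text \<open>Two different entries of \<open>q\<close> sum to at most 1, and on such pairs
  \<open>x * (1 - x)\<close> is ordered as \<open>x\<close> is. Chebyshev's inequality is applied to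
  \<open>q\<close> and the negative of \<open>q * (1 - q)\<close>.\<close>

lemma sum_cube_weights_le:
  fixes q :: "'a \<Rightarrow> real"
  assumes S: "finite S" and q0: "\<And>a. a \<in> S \<Longrightarrow> q a \<ge> 0" and q1: "sum q S = 1"
  shows "card S * (\<Sum>a\<in>S. q a * (1 - q a)\<^sup>2) \<le> (real (card S) - 1) * (\<Sum>a\<in>S. q a * (1 - q a))"
proof -
  have "(q a - q b) * (- (q a * (1 - q a)) - - (q b * (1 - q b))) \<le> 0" if "a \<in> S" "b \<in> S" for a b
  proof (cases "a = b")
    case False
    have "q a + q b = sum q {a, b}" using False by simp
    also have "\<dots> \<le> 1" unfolding q1[symmetric] using S that q0 by (intro sum_mono2) auto
    finally have "(q a - q b)\<^sup>2 * (1 - q a - q b) \<ge> 0" by simp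
    then show ?thesis by (simp add: power2_eq_square algebra_simps)
  qed simp
  then have "card S * (\<Sum>a\<in>S. q a * (- (q a * (1 - q a)))) \<le> sum q S * (\<Sum>a\<in>S. - (q a * (1 - q a)))"
    by (rule oppositely_ordered_sum_le)
  moreover have "(\<Sum>a\<in>S. q a * (1 - q a)\<^sup>2) = (\<Sum>a\<in>S. q a * (1 - q a)) + (\<Sum>a\<in>S. q a * (- (q a * (1 - q a))))"
    by (simp add: sum.distrib[symmetric] power2_eq_square algebra_simps)
  ultimately show ?thesis
    using q1 by (simp only: sum_negf) (simp add: distrib_left left_diff_distrib)
qed

text \<open>\<open>g w\<close> is the distribution of a coordinate on the class \<open>w\<close>, of relative size \<open>l w\<close>.\<close>

lemma class_average_le_pos:
  fixes g :: "'w \<Rightarrow> 'a \<Rightarrow> real" and l :: "'w \<Rightarrow> real"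
  assumes S: "finite S" and k: "card S = k" "k \<ge> 3"
    and l0: "\<And>w. w \<in> W \<Longrightarrow> l w \<ge> 0"
    and g0: "\<And>w a. w \<in> W \<Longrightarrow> a \<in> S \<Longrightarrow> g w a \<ge> 0" and g1: "\<And>w. w \<in> W \<Longrightarrow> sum (g w) S = 1"
    and f: "\<And>a. a \<in> S \<Longrightarrow> f a = (\<Sum>w\<in>W. l w * g w a)"
    and f0: "\<And>a. a \<in> S \<Longrightarrow> f a > 0" and f1: "sum f S = 1"
  shows "(\<Sum>w\<in>W. l w * (\<Sum>a\<in>S. \<Sum>b\<in>S - {a}. g w a * g w b * distinct_sum f (k - 3) (S - {a} - {b})))
           \<le> fact k / real k ^ (k - 1)"
proof -
  obtain n where n: "k = n + 3" using k by (metis le_add_diff_inverse2)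
  define P G q where "P = prod f S" and "G = (\<Sum>a\<in>S. 1 / f a)" and "q a = 1 / (f a * G)" for a
  have "S \<noteq> {}" using f1 by auto
  then have P: "P > 0" and G: "G > 0" unfolding P_def G_def using S f0 by (auto intro!: prod_pos sum_pos)
  have q0: "q a \<ge> 0" if "a \<in> S" for a using f0[OF that] G by (simp add: q_def)
  have q1: "sum q S = 1"
  proof -
    have "sum q S = (\<Sum>a\<in>S. 1 / f a) / G"
      unfolding sum_divide_distrib by (simp add: q_def)
    then show ?thesis using G by (simp add: G_def)
  qed
  \<comment> \<open>Of the \<open>k - 2\<close> remaining symbols a tuple of length
    \<open>n = k - 3\<close> omits one, so the inverses sum to \<open>G\<close> without two terms.
    In the variables \<open>u = g w / f\<close> the double sum becomes the form of
    \<open>lorentzian_form_le\<close>.\<close>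
  have D: "distinct_sum f n (S - {a} - {b}) = fact n * P * G * (1 - q a - q b) / (f a * f b)"
    if ab: "a \<in> S" "b \<in> S - {a}" for a b
  proof -
    have pos: "f a > 0" "f b > 0" using ab f0 by auto
    have "distinct_sum f n (S - {a} - {b}) = fact n * prod f (S - {a} - {b}) * (\<Sum>c\<in>S - {a} - {b}. 1 / f c)"
      using S ab k n f0 by (intro distinct_sum_card_minus_1) auto
    also have "prod f (S - {a} - {b}) = P / (f a * f b)"
      using S ab pos by (simp add: P_def prod.remove[of S a] prod.remove[of "S - {a}" b])
    also have "(\<Sum>c\<in>S - {a} - {b}. 1 / f c) = G - 1 / f a - 1 / f b"
      using S ab by (simp add: G_def sum.remove[of S a] sum.remove[of "S - {a}" b])
    also have "\<dots> = G * (1 - q a - q b)" using G by (simp add: q_def field_simps)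
    finally show ?thesis by (simp add: mult_ac)
  qed
  have single: "(\<Sum>a\<in>S. \<Sum>b\<in>S - {a}. g w a * g w b * distinct_sum f n (S - {a} - {b}))
      \<le> fact n * P * G * ((real k - 2) / (real k - 1)) * (\<Sum>a\<in>S. g w a * ((1 - q a) / f a)\<^sup>2)"
    if w: "w \<in> W" for w
  proof -
    define u where "u a = g w a / f a" for a
    have "(\<Sum>a\<in>S. \<Sum>b\<in>S - {a}. g w a * g w b * distinct_sum f n (S - {a} - {b})) =
        fact n * P * G * (\<Sum>a\<in>S. \<Sum>b\<in>S - {a}. u a * u b * (1 - q a - q b))"
      unfolding sum_distrib_left by (intro sum.cong refl) (simp add: D u_def)
    moreover have "(\<Sum>a\<in>S. \<Sum>b\<in>S - {a}. u a * u b * (1 - q a - q b)) \<le>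
        (real k - 2) / (real k - 1) * (\<Sum>a\<in>S. u a * (1 - q a))\<^sup>2"
      using lorentzian_form_le[OF S q0 q1, of u] k by (simp add: field_simps)
    moreover have "(real k - 2) / (real k - 1) * (\<Sum>a\<in>S. u a * (1 - q a))\<^sup>2 \<le>
        (real k - 2) / (real k - 1) * (\<Sum>a\<in>S. g w a * ((1 - q a) / f a)\<^sup>2)"
    proof -
      \<comment> \<open>Jensen's inequality for the square makes the bound linear in
        \<open>g w\<close>; averaging over the classes then replaces \<open>g w\<close> by its mean
        \<open>f\<close>.\<close>
      have "(\<Sum>a\<in>S. g w a *\<^sub>R ((1 - q a) / f a))\<^sup>2 \<le> (\<Sum>a\<in>S. g w a * ((1 - q a) / f a)\<^sup>2)"
        by (rule convex_on_sum[OF S \<open>S \<noteq> {}\<close> convex_power2]) (use g0 g1 w in auto)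
      then show ?thesis using k by (intro mult_left_mono) (simp_all add: u_def)
    qed
    ultimately show ?thesis using P G
      by (simp only: mult.assoc) (intro mult_left_mono, auto)
  qed
  have "(\<Sum>w\<in>W. l w * (\<Sum>a\<in>S. \<Sum>b\<in>S - {a}. g w a * g w b * distinct_sum f n (S - {a} - {b}))) \<le>
      (\<Sum>w\<in>W. l w * (fact n * P * G * ((real k - 2) / (real k - 1)) * (\<Sum>a\<in>S. g w a * ((1 - q a) / f a)\<^sup>2)))"
    by (intro sum_mono mult_left_mono single l0)
  also have "\<dots> = fact n * P * G * ((real k - 2) / (real k - 1)) * 
      (\<Sum>w\<in>W. \<Sum>a\<in>S. l w * g w a * ((1 - q a) / f a)\<^sup>2)"
    unfolding sum_distrib_left by (intro sum.cong refl) simp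
  also have "(\<Sum>w\<in>W. \<Sum>a\<in>S. l w * g w a * ((1 - q a) / f a)\<^sup>2) = (\<Sum>a\<in>S. f a * ((1 - q a) / f a)\<^sup>2)"
    by (subst sum.swap) (simp add: f sum_distrib_right)
  also have "\<dots> = G * (\<Sum>a\<in>S. q a * (1 - q a)\<^sup>2)"
    unfolding sum_distrib_left
  proof (intro sum.cong refl)
    fix a assume "a \<in> S"
    then have "f a > 0" by (rule f0)
    then have "G * q a = 1 / f a" using G by (simp add: q_def)
    then show "f a * ((1 - q a) / f a)\<^sup>2 = G * (q a * (1 - q a)\<^sup>2)"
      using \<open>f a > 0\<close> by (simp add: mult.assoc[symmetric] power2_eq_square)
  qed
  also have "fact n * P * G * ((real k - 2) / (real k - 1)) * (G * (\<Sum>a\<in>S. q a * (1 - q a)\<^sup>2)) \<le>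
      fact n * P * G * ((real k - 2) / (real k - 1)) * (G * ((real k - 1) / k * (\<Sum>a\<in>S. q a * (1 - q a))))"
    using sum_cube_weights_le[OF S q0 q1] k P G
    by (intro mult_left_mono) (simp_all add: field_simps)
  also have "\<dots> = fact n * ((real k - 2) / k) * (P * (G\<^sup>2 * (\<Sum>a\<in>S. q a * (1 - q a))))"
    using k by (simp add: power2_eq_square)
  also have "G\<^sup>2 * (\<Sum>a\<in>S. q a * (1 - q a)) = G\<^sup>2 - (\<Sum>a\<in>S. (1 / f a)\<^sup>2)"
  proof -
    have "(\<Sum>a\<in>S. (1 / f a)\<^sup>2) = G\<^sup>2 * (\<Sum>a\<in>S. q a * q a)"
      unfolding sum_distrib_left using G by (simp add: q_def power2_eq_square)
    then show ?thesis using q1 by (simp add: right_diff_distrib sum_subtractf)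
  qed
  \<comment> \<open>What is left is again symmetric in \<open>f\<close>: a distinct sum of length
    \<open>k - 2\<close>, which Maclaurin's inequality compares with the uniform
    distribution.\<close>
  also have "P * (G\<^sup>2 - (\<Sum>a\<in>S. (1 / f a)\<^sup>2)) = 2 * distinct_sum f (n + 1) S / fact (n + 1)"
    using distinct_sum_card_minus_2[OF S f0, where j = "n + 1"] k n
    by (simp add: P_def G_def field_simps del: fact_Suc distinct_sum.simps)
  also have "fact n * ((real k - 2) / k) * (2 * distinct_sum f (n + 1) S / fact (n + 1)) =
      2 * distinct_sum f (n + 1) S / k"
  proof -
    have *: "fact (n + 1) = (real k - 2) * fact n" using n by (simp add: algebra_simps)
    show ?thesis using k unfolding * by (simp del: distinct_sum.simps)
  qed
  also have "\<dots> \<le> fact k / real k ^ (n + 1) / k"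
  proof -
    have "card S - (n + 1) = 2" "n + 1 \<le> card S" using k n by auto
    then have "distinct_sum f (n + 1) S \<le> fact k / (2 * real k ^ (n + 1))"
      using distinct_sum_maclaurin[OF S less_imp_le[OF f0] f1, where j = "n + 1"] k by simp
    also have "\<dots> = fact k / real k ^ (n + 1) / 2" by simp
    finally have "2 * distinct_sum f (n + 1) S \<le> 2 * (fact k / real k ^ (n + 1) / 2)"
      by (rule mult_left_mono) simp
    then have "2 * distinct_sum f (n + 1) S \<le> fact k / real k ^ (n + 1)"
      by (simp del: distinct_sum.simps power_Suc)
    then show ?thesis by (rule divide_right_mono) simp
  qed
  also have "\<dots> = fact k / real k ^ (k - 1)" using n by (simp add: mult.commute)
  finally show ?thesis using n by simp
qed

text \<open>A symbol may be absent from a coordinate, and then the weights \<open>1 / f a\<close>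
  make no sense. The positive case extends by continuity.\<close>

lemma class_average_le:
  fixes g :: "'w \<Rightarrow> 'a \<Rightarrow> real" and l :: "'w \<Rightarrow> real"
  assumes S: "finite S" and k: "card S = k" "k \<ge> 3"
    and l0: "\<And>w. w \<in> W \<Longrightarrow> l w \<ge> 0" and l1: "sum l W = 1"
    and g0: "\<And>w a. w \<in> W \<Longrightarrow> a \<in> S \<Longrightarrow> g w a \<ge> 0" and g1: "\<And>w. w \<in> W \<Longrightarrow> sum (g w) S = 1"
    and f: "\<And>a. a \<in> S \<Longrightarrow> f a = (\<Sum>w\<in>W. l w * g w a)"
  shows "(\<Sum>w\<in>W. l w * (\<Sum>a\<in>S. \<Sum>b\<in>S - {a}. g w a * g w b * distinct_sum f (k - 3) (S - {a} - {b})))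
           \<le> fact k / real k ^ (k - 1)"
proof -
  have k0: "real k \<noteq> 0" using k by simp
  \<comment> \<open>Perturb towards the uniform distribution to make \<open>f\<close> positive.\<close>
  define gt where "gt t w a = (1 - t) * g w a + t / k" for t w a
  define ft where "ft t a = (1 - t) * f a + t / k" for t a
  define F where "F t = (\<Sum>w\<in>W. l w * (\<Sum>a\<in>S. \<Sum>b\<in>S - {a}. gt t w a * gt t w b *
      distinct_sum (ft t) (k - 3) (S - {a} - {b})))" for t
  have cont: "isCont (\<lambda>t. distinct_sum (ft t) j A) 0" for j A
    using k by (induction j arbitrary: A) (auto simp: ft_def intro!: continuous_intros)
  have "isCont F 0" unfolding F_def gt_def by (intro continuous_intros cont k0)
  then have "(F \<longlongrightarrow> F 0) (at_right 0)"
    by (simp add: isCont_def filterlim_at_split)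
  moreover have "F t \<le> fact k / real k ^ (k - 1)" if t: "0 < t" "t < 1" for t
    unfolding F_def
  proof (rule class_average_le_pos[OF S k l0])
    have f_nonneg: "f a \<ge> 0" if "a \<in> S" for a
      using that l0 g0 by (auto simp: f intro!: sum_nonneg)
    have "sum f S = (\<Sum>w\<in>W. l w * sum (g w) S)"
      by (simp add: f sum_distrib_left) (rule sum.swap)
    then have f1: "sum f S = 1" using g1 l1 by simp
    show "gt t w a \<ge> 0" if "w \<in> W" "a \<in> S" for w a
      using that t k g0 by (simp add: gt_def)
    show "sum (gt t w) S = 1" if "w \<in> W" for w
      using g1[OF that] k by (simp add: gt_def sum.distrib sum_distrib_left[symmetric])
    show "ft t a = (\<Sum>w\<in>W. l w * gt t w a)" if "a \<in> S" for a
    proof -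
      have "(\<Sum>w\<in>W. l w * gt t w a) = (\<Sum>w\<in>W. (1 - t) * (l w * g w a) + l w * (t / k))"
        by (intro sum.cong refl) (simp add: gt_def algebra_simps)
      also have "\<dots> = (1 - t) * f a + sum l W * (t / k)"
        by (simp only: sum.distrib sum_distrib_left[symmetric] sum_distrib_right[symmetric] f[OF that])
      finally show ?thesis using l1 by (simp add: ft_def)
    qed
    show "ft t a > 0" if "a \<in> S" for a
      using f_nonneg[OF that] t k by (simp add: ft_def add_nonneg_pos)
    show "sum (ft t) S = 1"
      using f1 k by (simp add: ft_def sum.distrib sum_distrib_left[symmetric])
  qed
  then have "eventually (\<lambda>t. F t \<le> fact k / real k ^ (k - 1)) (at_right 0)"
    by (auto simp: eventually_at_right_field intro!: exI[of _ 1])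
  ultimately have "F 0 \<le> fact k / real k ^ (k - 1)"
    by (intro tendsto_upperbound) auto
  moreover have "ft 0 = f" by (simp add: ft_def fun_eq_iff)
  ultimately show ?thesis by (simp add: F_def gt_def)
qed

section \<open>Averaging Hansel's lemma over codewords\<close>

text \<open>Where the \<open>k - 2\<close> codewords of \<open>xs\<close> show distinct symbols, two
  symbols are left, and they form the two sides of a bipartite graph on the other codewords. The
  hash property for \<open>y\<close>, \<open>z\<close> and \<open>xs\<close> says that some
  coordinate separates \<open>y\<close> from \<open>z\<close>.\<close>

lemma hash_code_hansel:
  assumes C: "is_hash_code k n C" and k: "k \<ge> 2"
    and xs: "distinct xs" "set xs \<subseteq> C" "length xs = k - 2" and card: "card C > k - 2"
  shows "log 2 (real (card C) - real (k - 2)) \<le>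
    (\<Sum>i<n. real (card {z\<in>C. distinct (map (\<lambda>c. c ! i) (z # xs))})) / (real (card C) - real (k - 2))"
proof -
  have fin: "finite C" using card by (metis card.infinite not_less_zero)
  define V where "V = C - set xs"
  define \<mu> where "\<mu> i = Min ({1..k} - (\<lambda>c. c ! i) ` set xs)" for i
  define E where "E i = {z\<in>V. distinct (map (\<lambda>c. c ! i) (z # xs))}" for i
  define A B where "A i = {z\<in>E i. z ! i = \<mu> i}" and "B i = {z\<in>E i. z ! i \<noteq> \<mu> i}" for i
  have cardV: "real (card V) = real (card C) - real (k - 2)"
    using xs fin card by (simp add: V_def card_Diff_subset distinct_card of_nat_diff)
  have "log 2 (card V) \<le> (\<Sum>i<n. real (card (V \<inter> (A i \<union> B i)))) / card V"
  proof (rule hansel)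
    show "V \<noteq> {}" using cardV card by auto
    fix y z assume yz: "y \<in> V" "z \<in> V" "y \<noteq> z"
    define T where "T = insert y (insert z (set xs))"
    have cardT: "card T = k" using yz xs k by (simp add: T_def V_def distinct_card)
    moreover have "T \<subseteq> C" using yz xs by (auto simp: T_def V_def)
    ultimately obtain i where i: "i < n" "(\<lambda>c. c ! i) ` T = {1..k}"
      using C by (auto simp: is_hash_code_def)
    have inj: "inj_on (\<lambda>c. c ! i) T"
      using i cardT by (intro eq_card_imp_inj_on) (auto simp: T_def)
    have ne: "y ! i \<noteq> z ! i" using inj yz by (auto simp: T_def inj_on_def)
    have out: "y ! i \<notin> (\<lambda>c. c ! i) ` set xs" "z ! i \<notin> (\<lambda>c. c ! i) ` set xs"
      using inj yz by (auto simp: T_def V_def inj_on_def)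
    have "inj_on (\<lambda>c. c ! i) (set xs)" using inj by (rule inj_on_subset) (auto simp: T_def)
    then have E: "y \<in> E i" "z \<in> E i" using yz out xs(1) by (simp_all add: E_def distinct_map)
    have "{1..k} - (\<lambda>c. c ! i) ` set xs = {y ! i, z ! i}"
      using i(2) out by (auto simp: T_def)
    then have "\<mu> i = y ! i \<or> \<mu> i = z ! i" by (auto simp: \<mu>_def min_def)
    then have "(y \<in> A i \<and> z \<in> B i) \<or> (z \<in> A i \<and> y \<in> B i)"
      unfolding A_def B_def mem_Collect_eq using E ne by metis
    with i(1) show "\<exists>i\<in>{..<n}. (y \<in> A i \<and> z \<in> B i) \<or> (z \<in> A i \<and> y \<in> B i)"
      by blast
  qed (use fin in \<open>auto simp: V_def A_def B_def\<close>)
  also have "\<dots> \<le> (\<Sum>i<n. real (card {z\<in>C. distinct (map (\<lambda>c. c ! i) (z # xs))})) / card V"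
    using fin by (intro divide_right_mono sum_mono of_nat_mono card_mono)
      (auto simp: A_def B_def E_def V_def)
  finally show ?thesis by (simp add: cardV)
qed

section \<open>Counting independent tuples of codewords\<close>

definition tuples :: "nat \<Rightarrow> 'a set \<Rightarrow> 'a list set" where
  "tuples m C = {xs. set xs \<subseteq> C \<and> length xs = m}"

lemma sum_tuples_Suc:
  "(\<Sum>xs\<in>tuples (Suc m) C. F xs) = (\<Sum>x\<in>C. \<Sum>xs\<in>tuples m C. F (x # xs))"
proof -
  have "tuples (Suc m) C = (\<lambda>(x, xs). x # xs) ` (C \<times> tuples m C)"
    by (auto simp: tuples_def length_Suc_conv image_iff)
  then have "(\<Sum>xs\<in>tuples (Suc m) C. F xs) = (\<Sum>(x, xs)\<in>C \<times> tuples m C. F (x # xs))"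
    by (simp add: sum.reindex inj_on_def case_prod_unfold)
  then show ?thesis by (simp add: sum.cartesian_product)
qed

lemma sum_over_symbols:
  fixes F :: "'b \<Rightarrow> real"
  assumes "finite C" "finite A" "s ` C \<subseteq> A"
  shows "(\<Sum>x\<in>C. F (s x)) = (\<Sum>a\<in>A. real (card {x\<in>C. s x = a}) * F a)"
proof -
  have "(\<Sum>x\<in>C. F (s x)) = (\<Sum>a\<in>A. \<Sum>x\<in>{x\<in>C. s x = a}. F (s x))"
    using assms by (intro sum.group[symmetric]) auto
  then show ?thesis by simp
qed

text \<open>Only the number of codewords with each symbol matters. The forbidden set
  \<open>Z\<close> is general because the induction adds the symbol of the head to it.\<close>

lemma sum_tuples_distinct:
  fixes s :: "'a \<Rightarrow> 'b"
  assumes C: "finite C" and A: "finite A" "s ` C \<subseteq> A"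
  shows "(\<Sum>xs\<in>tuples m C. of_bool (distinct (map s xs) \<and> s ` set xs \<inter> Z = {})) =
    distinct_sum (\<lambda>a. real (card {x\<in>C. s x = a})) m (A - Z)"
proof (induction m arbitrary: Z)
  case 0
  have "tuples 0 C = {[]}" by (auto simp: tuples_def)
  then show ?case by simp
next
  case (Suc m)
  let ?D = "distinct_sum (\<lambda>a. real (card {x\<in>C. s x = a})) m"
  have "(\<Sum>xs\<in>tuples (Suc m) C. of_bool (distinct (map s xs) \<and> s ` set xs \<inter> Z = {})) =
    (\<Sum>x\<in>C. (of_bool (s x \<notin> Z) :: real) *
      (\<Sum>xs\<in>tuples m C. of_bool (distinct (map s xs) \<and> s ` set xs \<inter> insert (s x) Z = {})))"
    unfolding sum_tuples_Suc sum_distrib_left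
    by (intro sum.cong refl) (auto simp: of_bool_def)
  also have "\<dots> = (\<Sum>x\<in>C. of_bool (s x \<notin> Z) * ?D (A - insert (s x) Z))"
    by (simp only: Suc.IH)
  also have "\<dots> = (\<Sum>a\<in>A. real (card {x\<in>C. s x = a}) * (of_bool (a \<notin> Z) * ?D (A - insert a Z)))"
    by (rule sum_over_symbols[OF C A])
  also have "\<dots> = (\<Sum>a\<in>A - Z. real (card {x\<in>C. s x = a}) * ?D (A - Z - {a}))"
    using A by (intro sum.mono_neutral_cong_right) (auto simp flip: Diff_insert)
  finally show ?case by simp
qed

text \<open>The distinct sum is a falling factorial with \<open>m\<close> factors, each at least
  \<open>card S - m\<close>. It counts the tuples without repeated codewords.\<close>

lemma distinct_sum_one_ge:
  fixes f :: "'a \<Rightarrow> real"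
  assumes "finite S" "card S \<ge> m" "\<And>a. a \<in> S \<Longrightarrow> f a = 1"
  shows "(real (card S) - m) ^ m \<le> distinct_sum f m S"
  using assms
proof (induction m arbitrary: S)
  case (Suc m)
  have "(real (card S) - Suc m) ^ Suc m \<le> card S * (real (card S) - Suc m) ^ m"
    using Suc.prems by (auto intro!: mult_right_mono)
  also have "\<dots> \<le> (\<Sum>a\<in>S. f a * distinct_sum f m (S - {a}))"
  proof (rule sum_bounded_below)
    fix a assume a: "a \<in> S"
    then have "(real (card (S - {a})) - m) ^ m \<le> distinct_sum f m (S - {a})"
      using Suc.prems by (intro Suc.IH) auto
    moreover have "real (card (S - {a})) - m = real (card S) - Suc m"
      using a Suc.prems by (simp add: of_nat_diff)
    ultimately show "(real (card S) - Suc m) ^ m \<le> f a * distinct_sum f m (S - {a})"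
      using Suc.prems(3)[OF a] by simp
  qed
  finally show ?case by simp
qed simp

lemma sum_over_classes:
  fixes F :: "'a \<Rightarrow> 'a \<Rightarrow> real"
  assumes C: "finite C"
  shows "(\<Sum>x\<in>C. \<Sum>y\<in>{y\<in>C. p y = p x}. F x y / card {y\<in>C. p y = p x}) =
    (\<Sum>w\<in>p ` C. (\<Sum>x\<in>{x\<in>C. p x = w}. \<Sum>y\<in>{y\<in>C. p y = w}. F x y) / card {y\<in>C. p y = w})"
proof -
  have "(\<Sum>x\<in>C. \<Sum>y\<in>{y\<in>C. p y = p x}. F x y / card {y\<in>C. p y = p x}) =
    (\<Sum>w\<in>p ` C. \<Sum>x\<in>{x\<in>C. p x = w}. \<Sum>y\<in>{y\<in>C. p y = p x}. F x y / card {y\<in>C. p y = p x})"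
    using C by (intro sum.group[symmetric]) auto
  also have "\<dots> = (\<Sum>w\<in>p ` C. (\<Sum>x\<in>{x\<in>C. p x = w}. \<Sum>y\<in>{y\<in>C. p y = w}. F x y) / card {y\<in>C. p y = w})"
    unfolding sum_divide_distrib by (intro sum.cong refl) auto
  finally show ?thesis .
qed

text \<open>One coordinate \<open>s\<close>: \<open>x\<close> is uniform, \<open>y\<close> uniform in the class of \<open>x\<close>, the rest uniform.\<close>

lemma coordinate_bound:
  fixes s :: "'a \<Rightarrow> 'b" and p :: "'a \<Rightarrow> 'p"
  assumes C: "finite C" "C \<noteq> {}" and A: "finite A" "s ` C \<subseteq> A" "card A = k" and k: "k \<ge> 4"
  shows "(\<Sum>x\<in>C. \<Sum>y\<in>{y\<in>C. p y = p x}. (\<Sum>zs\<in>tuples (k - 4) C.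
      real (card {z\<in>C. distinct (map s (z # x # y # zs))})) / card {y\<in>C. p y = p x})
    \<le> real (card C) ^ (k - 2) * (fact k / real k ^ (k - 1))"
proof -
  define N where "N = real (card C)"
  have N: "N > 0" using C by (simp add: N_def card_gt_0_iff)
  define M where "M w = real (card {x\<in>C. p x = w})" for w
  have M: "M w > 0" if "w \<in> p ` C" for w using that C by (auto simp: M_def card_gt_0_iff)
  define c where "c w a = real (card {x\<in>C. p x = w \<and> s x = a})" for w a
  define cnt where "cnt a = real (card {x\<in>C. s x = a})" for a
  define D where "D a b = distinct_sum cnt (k - 3) (A - {a} - {b})" for a b
  define f where "f a = cnt a / N" for a
  define g where "g w a = c w a / M w" for w a
  define l where "l w = M w / N" for w
  \<comment> \<open>The codeword \<open>z\<close> counted by Hansel's lemma joins \<open>zs\<close>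
    to form an independent tuple of length \<open>k - 3\<close> that must avoid the symbols of
    \<open>x\<close> and \<open>y\<close>.\<close>
  have tup: "(\<Sum>zs\<in>tuples (k - 4) C. real (card {z\<in>C. distinct (map s (z # x # y # zs))})) =
      of_bool (s x \<noteq> s y) * D (s x) (s y)" for x y
  proof -
    have "(\<Sum>zs\<in>tuples (k - 4) C. real (card {z\<in>C. distinct (map s (z # x # y # zs))})) =
        (\<Sum>zs\<in>tuples (k - 4) C. \<Sum>z\<in>C. of_bool (distinct (map s (z # x # y # zs))))"
      using C by (simp add: of_bool_def sum.If_cases Int_def)
    also have "\<dots> = (\<Sum>z\<in>C. \<Sum>zs\<in>tuples (k - 4) C. of_bool (distinct (map s (z # x # y # zs))))"
      by (rule sum.swap)
    also have "\<dots> = (\<Sum>z\<in>C. \<Sum>zs\<in>tuples (k - 4) C. of_bool (s x \<noteq> s y) *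
        of_bool (distinct (map s (z # zs)) \<and> s ` set (z # zs) \<inter> {s x, s y} = {}))"
      by (intro sum.cong refl) (auto simp: of_bool_def)
    also have "\<dots> = of_bool (s x \<noteq> s y) * (\<Sum>zs\<in>tuples (Suc (k - 4)) C.
        of_bool (distinct (map s zs) \<and> s ` set zs \<inter> {s x, s y} = {}))"
      unfolding sum_tuples_Suc sum_distrib_left ..
    also have "\<dots> = of_bool (s x \<noteq> s y) * distinct_sum cnt (Suc (k - 4)) (A - {s x, s y})"
      unfolding cnt_def by (subst sum_tuples_distinct[OF C(1) A(1,2)]) simp
    also have "Suc (k - 4) = k - 3" using k by simp
    also have "A - {s x, s y} = A - {s x} - {s y}" by auto
    finally show ?thesis by (simp add: D_def)
  qed
  have cl: "(\<Sum>x\<in>{x\<in>C. p x = w}. \<Sum>y\<in>{y\<in>C. p y = w}. of_bool (s x \<noteq> s y) * D (s x) (s y)) =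
      (\<Sum>a\<in>A. \<Sum>b\<in>A - {a}. c w a * c w b * D a b)" for w
  proof -
    have sub: "finite {x\<in>C. p x = w}" "s ` {x\<in>C. p x = w} \<subseteq> A" using C A by auto
    have cw: "c w a = real (card {x \<in> {x\<in>C. p x = w}. s x = a})" for a
      by (simp add: c_def conj_assoc)
    have "(\<Sum>x\<in>{x\<in>C. p x = w}. \<Sum>y\<in>{y\<in>C. p y = w}. of_bool (s x \<noteq> s y) * D (s x) (s y)) =
      (\<Sum>x\<in>{x\<in>C. p x = w}. \<Sum>b\<in>A. c w b * (of_bool (s x \<noteq> b) * D (s x) b))"
      unfolding cw by (intro sum.cong refl sum_over_symbols[OF sub(1) A(1) sub(2)])
    also have "\<dots> = (\<Sum>a\<in>A. c w a * (\<Sum>b\<in>A. c w b * (of_bool (a \<noteq> b) * D a b)))"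
      unfolding cw by (rule sum_over_symbols[OF sub(1) A(1) sub(2)])
    also have "\<dots> = (\<Sum>a\<in>A. \<Sum>b\<in>A - {a}. c w a * c w b * D a b)"
    proof (intro sum.cong refl)
      fix a
      have "(\<Sum>b\<in>A. c w b * (of_bool (a \<noteq> b) * D a b)) = (\<Sum>b\<in>A - {a}. c w b * D a b)"
        using A by (intro sum.mono_neutral_cong_right) auto
      then show "c w a * (\<Sum>b\<in>A. c w b * (of_bool (a \<noteq> b) * D a b)) = (\<Sum>b\<in>A - {a}. c w a * c w b * D a b)"
        by (simp add: sum_distrib_left mult.assoc)
    qed
    finally show ?thesis .
  qed
  have D: "D a b = N ^ (k - 3) * distinct_sum f (k - 3) (A - {a} - {b})" for a b
  proof -
    have "cnt = (\<lambda>a. N * f a)" using N by (simp add: f_def)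
    then show ?thesis unfolding D_def by (simp only: distinct_sum_scale)
  qed
  have "(\<Sum>x\<in>C. \<Sum>y\<in>{y\<in>C. p y = p x}. (\<Sum>zs\<in>tuples (k - 4) C.
      real (card {z\<in>C. distinct (map s (z # x # y # zs))})) / card {y\<in>C. p y = p x}) =
    (\<Sum>w\<in>p ` C. (\<Sum>a\<in>A. \<Sum>b\<in>A - {a}. c w a * c w b * D a b) / M w)"
    unfolding tup by (subst sum_over_classes[OF C(1)]) (simp only: cl M_def)
  \<comment> \<open>Passing to frequencies: \<open>D\<close> yields \<open>N ^ (k - 3)\<close>, and
    the class size that survives the division by \<open>M w\<close> is
    \<open>N * l w\<close>.\<close>
  also have "\<dots> = (\<Sum>w\<in>p ` C. N ^ (k - 2) * (l w *
      (\<Sum>a\<in>A. \<Sum>b\<in>A - {a}. g w a * g w b * distinct_sum f (k - 3) (A - {a} - {b}))))"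
  proof (intro sum.cong refl)
    fix w assume "w \<in> p ` C"
    then have Mw: "M w > 0" by (rule M)
    have "k - 2 = Suc (k - 3)" using k by simp
    then have "c w a * c w b * D a b / M w =
        N ^ (k - 2) * (l w * (g w a * g w b * distinct_sum f (k - 3) (A - {a} - {b})))" for a b
      using Mw N by (simp add: D g_def l_def)
    then show "(\<Sum>a\<in>A. \<Sum>b\<in>A - {a}. c w a * c w b * D a b) / M w = N ^ (k - 2) * (l w *
      (\<Sum>a\<in>A. \<Sum>b\<in>A - {a}. g w a * g w b * distinct_sum f (k - 3) (A - {a} - {b})))"
      by (simp only: sum_divide_distrib sum_distrib_left)
  qed
  also have "\<dots> = N ^ (k - 2) * (\<Sum>w\<in>p ` C. l w *
      (\<Sum>a\<in>A. \<Sum>b\<in>A - {a}. g w a * g w b * distinct_sum f (k - 3) (A - {a} - {b})))"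
    by (rule sum_distrib_left[symmetric])
  also have "\<dots> \<le> N ^ (k - 2) * (fact k / real k ^ (k - 1))"
  proof (intro mult_left_mono class_average_le)
    show "0 \<le> l w" "0 \<le> g w a" for w a using N by (simp_all add: l_def g_def M_def c_def)
    have "(\<Sum>w\<in>p ` C. M w) = N"
      using sum_over_symbols[of C "p ` C" p "\<lambda>_. 1"] C by (simp add: M_def N_def)
    then show "sum l (p ` C) = 1" using N by (simp add: l_def sum_divide_distrib[symmetric])
    show "sum (g w) A = 1" if "w \<in> p ` C" for w
    proof -
      have "(\<Sum>a\<in>A. c w a) = M w"
        using sum_over_symbols[of "{x\<in>C. p x = w}" A s "\<lambda>_. 1"] C A
        by (simp add: M_def c_def conj_assoc image_subset_iff)
      then show ?thesis using M[OF that] by (simp add: g_def sum_divide_distrib[symmetric])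
    qed
    show "f a = (\<Sum>w\<in>p ` C. l w * g w a)" if "a \<in> A" for a
    proof -
      have "(\<Sum>w\<in>p ` C. c w a) = cnt a"
        using sum_over_symbols[of "{x\<in>C. s x = a}" "p ` C" p "\<lambda>_. 1"] C
        by (simp add: c_def cnt_def conj_ac image_subset_iff)
      moreover have "(\<Sum>w\<in>p ` C. l w * g w a) = (\<Sum>w\<in>p ` C. c w a / N)"
        using M by (intro sum.cong refl) (force simp: l_def g_def)
      ultimately show ?thesis by (simp add: f_def sum_divide_distrib[symmetric])
    qed
  qed (use A k N in auto)
  finally show ?thesis by (simp add: N_def)
qed

text \<open>Sum \<open>hash_code_hansel\<close> over \<open>x\<close> in \<open>C\<close>,
  \<open>y\<close> in the prefix class of \<open>x\<close> with weight 1 over the class size, and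
  all tuples \<open>zs\<close>. The first three factors and the logarithm bound the Hansel side from
  below, with allowance for repeated codewords; only the last \<open>n - r\<close> coordinates
  contribute on the right.\<close>

lemma hash_code_inequality:
  assumes C: "is_hash_code k n C" and k: "k \<ge> 4" and N: "card C > k" and ln: "r \<le> n"
  shows "(real (card C) - real k ^ r) * (real (card C) - k) ^ (k - 4) *
      (real (card C) - real (k - 2)) * log 2 (real (card C) - real (k - 2))
    \<le> real (card C) ^ (k - 2) * alpha_FK k * (real n - r)"
proof -
  have fin: "finite C" and ne: "C \<noteq> {}" using N by (auto intro: card_ge_0_finite)
  define p :: "nat list \<Rightarrow> nat list" where "p = take r"
  define cl where "cl x = {y\<in>C. p y = p x}" for x
  define m where "m = real (card C) - real (k - 2)"
  define K where "K = (real (card C) - k) ^ (k - 4)"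
  define t where "t i x y zs = real (card {z\<in>C. distinct (map (\<lambda>c. c ! i) (z # x # y # zs))})"
    for i and x y :: "nat list" and zs
  have m: "m > 1" using N k by (simp add: m_def of_nat_diff)
  have Cw: "C \<subseteq> words k n" using C by (simp add: is_hash_code_def)
  have hansel: "of_bool (distinct (x # y # zs)) * (m * log 2 m) \<le> (\<Sum>i<n. t i x y zs)"
    if "x \<in> C" "y \<in> cl x" "zs \<in> tuples (k - 4) C" for x y zs
  proof (cases "distinct (x # y # zs)")
    case True
    have "log 2 m \<le> (\<Sum>i<n. t i x y zs) / m"
      unfolding m_def t_def using C k True that N
      by (intro hash_code_hansel) (auto simp: cl_def tuples_def)
    then show ?thesis using True m by (simp add: field_simps)
  next
    case False
    then show ?thesis unfolding t_def by (auto intro!: sum_nonneg)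
  qed
  have many: "of_bool (x \<noteq> y) * K \<le> (\<Sum>zs\<in>tuples (k - 4) C. of_bool (distinct (x # y # zs)))"
    if xy: "x \<in> C" "y \<in> C" for x y
  proof (cases "x = y")
    case False
    have "card (C - {x, y}) = card C - 2" using xy False fin by (simp add: card_Diff_subset)
    then have cardD: "real (card (C - {x, y})) = real (card C) - 2" using N k by (simp add: of_nat_diff)
    have "K \<le> (real (card (C - {x, y})) - real (k - 4)) ^ (k - 4)"
      unfolding K_def cardD using N k by (intro power_mono) (auto simp: of_nat_diff)
    also have "\<dots> \<le> distinct_sum (\<lambda>a. real (card {x\<in>C. id x = a})) (k - 4) (C - {x, y})"
    proof (rule distinct_sum_one_ge)
      show "k - 4 \<le> card (C - {x, y})" using cardD N by linarith
      fix a assume "a \<in> C - {x, y}"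
      then have "{x\<in>C. id x = a} = {a}" by auto
      then show "real (card {x\<in>C. id x = a}) = 1" by simp
    qed (use fin in auto)
    also have "\<dots> = (\<Sum>zs\<in>tuples (k - 4) C. of_bool (distinct (map id zs) \<and> id ` set zs \<inter> {x, y} = {}))"
      using sum_tuples_distinct[where m = "k - 4" and C = C and A = C and s = id and Z = "{x, y}"] fin by simp
    also have "\<dots> = (\<Sum>zs\<in>tuples (k - 4) C. of_bool (distinct (x # y # zs)))"
      using False by (intro sum.cong refl arg_cong[of _ _ of_bool]) auto
    finally show ?thesis using False by simp
  qed (auto intro!: sum_nonneg)
  have pC: "real (card (p ` C)) \<le> real k ^ r"
  proof -
    have "p ` C \<subseteq> {xs. set xs \<subseteq> {1..k} \<and> length xs = r}"
      using Cw ln by (auto simp: p_def words_def dest: in_set_takeD)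
    then have "card (p ` C) \<le> card {xs. set xs \<subseteq> {1..k} \<and> length xs = r}"
      by (intro card_mono finite_lists_length_eq) auto
    also have "\<dots> = k ^ r" by (subst card_lists_length_eq) auto
    finally show ?thesis by (metis of_nat_le_iff of_nat_power)
  qed
  \<comment> \<open>A class of size \<open>M\<close> contributes \<open>M - 1\<close>, so the loss
    from \<open>x = y\<close> is the number of prefixes, at most \<open>k ^ r\<close>.\<close>
  have classes: "(\<Sum>x\<in>C. \<Sum>y\<in>cl x. of_bool (x \<noteq> y) / card (cl x)) = real (card C) - card (p ` C)"
  proof -
    define M where "M w = real (card {y\<in>C. p y = w})" for w
    have "(\<Sum>x\<in>{x\<in>C. p x = w}. \<Sum>y\<in>{y\<in>C. p y = w}. of_bool (x \<noteq> y)) / M w = M w - 1"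
      if "w \<in> p ` C" for w
    proof -
      have M: "M w > 0" using that fin by (auto simp: M_def card_gt_0_iff)
      have "(\<Sum>y\<in>{y\<in>C. p y = w}. of_bool (x \<noteq> y)) = M w - 1" if "x \<in> {x\<in>C. p x = w}" for x
      proof -
        have "(\<Sum>y\<in>{y\<in>C. p y = w}. of_bool (x \<noteq> y)) = (\<Sum>y\<in>{y\<in>C. p y = w}. 1 - of_bool (x = y) :: real)"
          by (intro sum.cong) auto
        then show ?thesis using that fin by (simp add: sum_subtractf M_def of_bool_def)
      qed
      then have "(\<Sum>x\<in>{x\<in>C. p x = w}. \<Sum>y\<in>{y\<in>C. p y = w}. of_bool (x \<noteq> y)) = M w * (M w - 1)"
        by (simp add: M_def)
      then show ?thesis using M by simp
    qed
    then have "(\<Sum>w\<in>p ` C. (\<Sum>x\<in>{x\<in>C. p x = w}. \<Sum>y\<in>{y\<in>C. p y = w}. of_bool (x \<noteq> y)) / M w)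
        = (\<Sum>w\<in>p ` C. M w - 1)"
      by (intro sum.cong refl)
    moreover have "(\<Sum>w\<in>p ` C. M w) = card C"
      using sum_over_symbols[of C "p ` C" p "\<lambda>_. 1"] fin by (simp add: M_def)
    ultimately show ?thesis unfolding cl_def
      by (subst sum_over_classes[OF fin]) (simp add: M_def sum_subtractf)
  qed
  have K0: "K \<ge> 0" using N by (simp add: K_def)
  have mlog: "m * log 2 m \<ge> 0" using m by simp
  have "(real (card C) - real k ^ r) * K * (m * log 2 m) \<le> (real (card C) - card (p ` C)) * K * (m * log 2 m)"
    using pC K0 mlog by (intro mult_right_mono) auto
  also have "\<dots> = (\<Sum>x\<in>C. \<Sum>y\<in>cl x. (of_bool (x \<noteq> y) * K) * (m * log 2 m) / card (cl x))"
    unfolding classes[symmetric] sum_distrib_right by (intro sum.cong refl) simp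
  also have "\<dots> \<le> (\<Sum>x\<in>C. \<Sum>y\<in>cl x. (\<Sum>zs\<in>tuples (k - 4) C. of_bool (distinct (x # y # zs))) * (m * log 2 m) / card (cl x))"
    by (intro sum_mono divide_right_mono mult_right_mono many mlog) (auto simp: cl_def)
  also have "\<dots> \<le> (\<Sum>x\<in>C. \<Sum>y\<in>cl x. (\<Sum>zs\<in>tuples (k - 4) C. \<Sum>i<n. t i x y zs) / card (cl x))"
    unfolding sum_distrib_right by (intro sum_mono divide_right_mono hansel) auto
  also have "\<dots> = (\<Sum>i<n. \<Sum>x\<in>C. \<Sum>y\<in>cl x. (\<Sum>zs\<in>tuples (k - 4) C. t i x y zs) / card (cl x))"
    by (simp only: sum_divide_distrib sum.swap[of _ "{..<n}"])
  also have "\<dots> = (\<Sum>i\<in>{r..<n}. \<Sum>x\<in>C. \<Sum>y\<in>cl x. (\<Sum>zs\<in>tuples (k - 4) C. t i x y zs) / card (cl x))"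
  proof (intro sum.mono_neutral_right ballI)
    fix i assume "i \<in> {..<n} - {r..<n}"
    then have "i < r" by auto
    \<comment> \<open>The gain over the uniform choice: \<open>x\<close> and \<open>y\<close> share
      their first \<open>r\<close> symbols, so no \<open>z\<close> is counted there.\<close>
    have "t i x y zs = 0" if "x \<in> C" "y \<in> cl x" for x y zs
    proof -
      have "x ! i = y ! i"
        using that \<open>i < r\<close> nth_take[of i r x] nth_take[of i r y] by (auto simp: cl_def p_def)
      then show ?thesis by (simp add: t_def)
    qed
    then show "(\<Sum>x\<in>C. \<Sum>y\<in>cl x. (\<Sum>zs\<in>tuples (k - 4) C. t i x y zs) / card (cl x)) = 0"
      by simp
  qed auto
  also have "\<dots> \<le> (\<Sum>i\<in>{r..<n}. real (card C) ^ (k - 2) * (fact k / real k ^ (k - 1)))"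
  proof (rule sum_mono)
    fix i assume "i \<in> {r..<n}"
    then have "c ! i \<in> {1..k}" if "c \<in> C" for c
      using that Cw nth_mem[of i c] by (auto simp: words_def subset_iff)
    then have "(\<lambda>c. c ! i) ` C \<subseteq> {1..k}" by blast
    then show "(\<Sum>x\<in>C. \<Sum>y\<in>cl x. (\<Sum>zs\<in>tuples (k - 4) C. t i x y zs) / card (cl x))
      \<le> real (card C) ^ (k - 2) * (fact k / real k ^ (k - 1))"
      unfolding t_def cl_def using fin ne k by (intro coordinate_bound) auto
  qed
  also have "\<dots> = real (card C) ^ (k - 2) * alpha_FK k * (real n - r)"
    using ln by (simp add: alpha_FK_def of_nat_diff)
  finally show ?thesis by (simp add: m_def K_def mult.assoc)
qed

section \<open>Asymptotics\<close>

lemma max_hash_size_attained: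
  assumes "k > 0"
  obtains C where "is_hash_code k n C" "card C = max_hash_size k n"
proof -
  have fin: "finite (words k n)"
    using finite_lists_length_eq[of "{1..k}" n] by (simp add: words_def conj_commute)
  have "{card C | C. is_hash_code k n C} \<subseteq> card ` Pow (words k n)" by (auto simp: is_hash_code_def)
  then have "finite {card C | C. is_hash_code k n C}"
    using fin by (meson finite_Pow_iff finite_imageI finite_subset)
  \<comment> \<open>The empty code has no subset of size \<open>k > 0\<close>, so the maximum is
    over a nonempty set.\<close>
  moreover have "card {} \<in> {card C | C. is_hash_code k n C}"
    by (rule CollectI, rule exI[of _ "{}"]) (use assms in \<open>auto simp: is_hash_code_def\<close>)
  ultimately have "max_hash_size k n \<in> {card C | C. is_hash_code k n C}"
    unfolding max_hash_size_def by (intro Max_in) auto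
  then show ?thesis using that by auto
qed

lemma alpha_FK_pos: "k > 0 \<Longrightarrow> alpha_FK k > 0"
  by (simp add: alpha_FK_def)

lemma alpha_FK_le_1:
  assumes "k > 0"
  shows "alpha_FK k \<le> 1"
proof -
  have "fact (Suc m) \<le> real (Suc m) ^ m" for m
  proof (induction m)
    case (Suc m)
    have "fact (Suc (Suc m)) \<le> real (Suc (Suc m)) * real (Suc m) ^ m"
      using Suc.IH by (subst fact_Suc) (rule mult_left_mono, auto)
    also have "\<dots> \<le> real (Suc (Suc m)) * real (Suc (Suc m)) ^ m"
      by (intro mult_left_mono power_mono) auto
    finally show ?case by simp
  qed simp
  from this[of "k - 1"] assms show ?thesis by (simp add: alpha_FK_def)
qed

text \<open>If the rate exceeded \<open>b\<close> for some large \<open>n\<close>, then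
  \<open>hash_code_inequality\<close>, with \<open>k ^ r\<close> exponentially smaller than the
  code, would give in the limit that \<open>b\<close> is at most
  \<open>alpha_FK k * (1 - c / log 2 k)\<close> for a \<open>c\<close> just below \<open>b\<close>,
  against the last hypothesis.\<close>

lemma R_hash_le:
  assumes k: "k \<ge> 4" and b: "0 < b" "b \<le> log 2 k" and ab: "alpha_FK k * (1 - b / log 2 k) < b"
  shows "R_hash k \<le> ereal b"
proof -
  define \<alpha> L where "\<alpha> = alpha_FK k" and "L = log 2 (real k)"
  have \<alpha>: "\<alpha> > 0" using k by (simp add: \<alpha>_def alpha_FK_pos)
  have L: "L > 0" using k by (simp add: L_def)
  have "L * (1 - b / \<alpha>) < b"
  proof -
    have "L * \<alpha> < b * L + b * \<alpha>" using ab L unfolding \<alpha>_def[symmetric] L_def[symmetric]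
      by (simp add: field_simps)
    then show ?thesis using \<alpha> by (simp add: field_simps)
  qed
  \<comment> \<open>The strict hypothesis leaves room below \<open>b\<close>: \<open>c\<close>
    exceeds the root of \<alpha> \<open>* (1 - c / L) = b\<close>, and \<open>c < b\<close> makes
    \<open>2 powr (c * n)\<close> negligible against \<open>X n\<close>.\<close>
  then obtain c where c: "max 0 (L * (1 - b / \<alpha>)) < c" "c < b" using b dense[of "max 0 (L * (1 - b / \<alpha>))" b] by auto
  then have c0: "c > 0" and "L * (1 - b / \<alpha>) < c" by auto
  then have cb: "\<alpha> * (1 - c / L) < b" using \<alpha> L by (simp add: field_simps)
  define X where "X n = 2 powr (b * real n)" for n
  \<comment> \<open>The left side of \<open>hash_code_inequality\<close> divided by
    \<open>N ^ (k - 2) * n\<close>, with \<open>N\<close> lowered to \<open>X n\<close>,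
    \<open>k ^ r\<close> raised to \<open>2 powr (c * n)\<close> and \<open>k - 2\<close> raised to
    \<open>k\<close>.\<close>
  define lhs where "lhs n = (1 - 2 powr (c * real n) / X n) * (1 - k / X n) ^ (k - 3) * (log 2 (X n - k) / n)" for n :: nat
  have "filterlim X at_top sequentially" unfolding X_def using b by real_asymp
  then have Xk: "eventually (\<lambda>n. X n > k + 1) sequentially" by (simp add: filterlim_at_top_dense)
  have t1: "(\<lambda>n. 1 - 2 powr (c * real n) / X n) \<longlonglongrightarrow> 1"
  proof -
    define e where "e = b - c"
    have "e > 0" using c by (simp add: e_def)
    then have "(\<lambda>n. 1 - 2 powr (- (e * real n))) \<longlonglongrightarrow> 1" by real_asymp
    then show ?thesis by (simp add: X_def e_def powr_diff[symmetric] algebra_simps)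
  qed
  have t2: "(\<lambda>n. 1 - k / X n) \<longlonglongrightarrow> 1"
    unfolding X_def using b by real_asymp
  have t3: "(\<lambda>n. log 2 (X n - k) / n) \<longlonglongrightarrow> b"
    unfolding X_def using b by real_asymp
  have "lhs \<longlonglongrightarrow> 1 * 1 ^ (k - 3) * b"
    unfolding lhs_def by (intro tendsto_intros t1 t2 t3)
  \<comment> \<open>The term \<open>1 / n\<close> pays for rounding \<open>r\<close> down to an
    integer.\<close>
  moreover have "(\<lambda>n. \<alpha> * (1 - c / L + 1 / real n)) \<longlonglongrightarrow> \<alpha> * (1 - c / L + 0)"
    by (intro tendsto_intros lim_1_over_n)
  ultimately have "(\<lambda>n. lhs n - \<alpha> * (1 - c / L + 1 / real n)) \<longlonglongrightarrow>
      1 * 1 ^ (k - 3) * b - \<alpha> * (1 - c / L + 0)"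
    by (rule tendsto_diff)
  then have "eventually (\<lambda>n. 0 < lhs n - \<alpha> * (1 - c / L + 1 / real n)) sequentially"
    using cb by (intro order_tendstoD(1)) auto
  then have ev: "eventually (\<lambda>n. lhs n > \<alpha> * (1 - c / L + 1 / real n)) sequentially"
    by eventually_elim simp
  have "eventually (\<lambda>n. hash_rate k n \<le> b) sequentially"
    using Xk ev eventually_gt_at_top[of 0]
  proof eventually_elim
    case (elim n)
    show ?case
    proof (rule ccontr)
      assume "\<not> hash_rate k n \<le> b"
      obtain C where C: "is_hash_code k n C" "card C = max_hash_size k n"
        using max_hash_size_attained[of k n] k by auto
      define N where "N = real (card C)"
      have logN: "log 2 N > b * n"
        using \<open>\<not> hash_rate k n \<le> b\<close> elim(3) by (simp add: hash_rate_def C(2) N_def field_simps)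
      \<comment> \<open>By convention \<open>log 2 0\<close> is 0, which is not above
        \<open>b * n\<close>.\<close>
      have "N \<noteq> 0" using logN b elim(3) by (auto simp: log_def mult_less_0_iff)
      then have "N > 0" by (simp add: N_def)
      then have NX: "X n < N" using logN by (simp add: X_def less_log_iff)
      define r where "r = nat \<lfloor>c * n / L\<rfloor>"
      have nonneg: "c * n / L \<ge> 0" using c0 L by simp
      have r_le: "real r \<le> c * n / L" using nonneg by (simp add: r_def)
      have r_ge: "real r \<ge> c * n / L - 1" using nonneg by (simp add: r_def)
      \<comment> \<open>Here \<open>b \<le> log 2 k\<close> ensures that the prefix is no longer
        than the codewords.\<close>
      have "c * n / L \<le> n" using c b L elim(3) by (simp add: field_simps L_def)
      then have ln: "r \<le> n" using r_le by linarith
      have kl: "real k ^ r \<le> 2 powr (c * n)"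
      proof -
        have "real k ^ r = 2 powr (L * r)" using k by (simp add: L_def powr_powr[symmetric] powr_realpow)
        also have "\<dots> \<le> 2 powr (c * n)" using r_le L by (simp add: field_simps)
        finally show ?thesis .
      qed
      have Nk: "N > k + 1" using NX elim(1) by simp
      have X0: "X n > 0" by (simp add: X_def)
      have "2 powr (c * n) / X n \<le> 1" using c by (simp add: X_def mult_right_mono)
      have kk: "k - 2 = Suc (k - 3)" "k - 3 = Suc (k - 4)" using k by auto
      have "(1 - 2 powr (c * n) / X n) * (1 - k / X n) ^ (k - 3) * log 2 (X n - k)
          \<le> (1 - real k ^ r / N) * ((1 - k / N) ^ (k - 4) * (1 - real (k - 2) / N)) * log 2 (N - real (k - 2))"
      proof (intro mult_mono)
        have "real k ^ r / N \<le> 2 powr (c * n) / X n" using kl NX X0 by (intro frac_le) auto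
        then show "1 - 2 powr (c * n) / X n \<le> 1 - real k ^ r / N" by simp
        then show "0 \<le> 1 - real k ^ r / N" using \<open>2 powr (c * n) / X n \<le> 1\<close> by linarith
        have "k / N \<le> k / X n" "real (k - 2) / N \<le> k / X n" using NX X0 by (auto intro!: frac_le)
        moreover have "k / X n \<le> 1" using elim(1) X0 by simp
        ultimately show "(1 - k / X n) ^ (k - 3) \<le> (1 - k / N) ^ (k - 4) * (1 - real (k - 2) / N)"
          unfolding kk(2) power_Suc2 by (intro mult_mono power_mono) auto
        show "log 2 (X n - k) \<le> log 2 (N - real (k - 2))" using NX elim(1) by simp
        show "0 \<le> log 2 (X n - k)" using elim(1) by simp
        show "0 \<le> (1 - k / X n) ^ (k - 3)" using \<open>k / X n \<le> 1\<close> by simp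
        then show "0 \<le> (1 - real k ^ r / N) * ((1 - k / N) ^ (k - 4) * (1 - real (k - 2) / N))"
          using \<open>(1 - k / X n) ^ (k - 3) \<le> (1 - k / N) ^ (k - 4) * (1 - real (k - 2) / N)\<close> \<open>0 \<le> 1 - real k ^ r / N\<close>
          by (intro mult_nonneg_nonneg[of "1 - real k ^ r / N"]) linarith+
      qed
      also have "\<dots> = (N - real k ^ r) * (N - k) ^ (k - 4) * (N - real (k - 2)) * log 2 (N - real (k - 2)) / N ^ (k - 2)"
      proof -
        have "1 - real k ^ r / N = (N - real k ^ r) / N" "1 - k / N = (N - k) / N"
          "1 - real (k - 2) / N = (N - real (k - 2)) / N"
          using \<open>N > 0\<close> by (simp_all add: diff_divide_distrib)
        moreover have "N ^ (k - 2) = N * (N ^ (k - 4) * N)" unfolding kk by simp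
        ultimately show ?thesis by (simp only: power_divide times_divide_times_eq) simp
      qed
      also have "\<dots> \<le> \<alpha> * (real n - r)"
        using hash_code_inequality[OF C(1) k _ ln] Nk \<open>N > 0\<close>
        by (simp add: N_def \<alpha>_def field_simps)
      also have "\<dots> \<le> \<alpha> * (n - c * n / L + 1)"
        using r_ge \<alpha> by (intro mult_left_mono) auto
      finally have "lhs n \<le> \<alpha> * (n - c * n / L + 1) / n"
        using elim(3) by (simp add: lhs_def divide_right_mono)
      also have "\<dots> = \<alpha> * (1 - c / L + 1 / n)" using elim(3) L by (simp add: field_simps)
      finally show False using elim(2) by simp
    qed
  qed
  then show ?thesis unfolding R_hash_def by (intro Limsup_bounded) (auto elim: eventually_mono)
qed

theorem theorem1:
  shows "(\<forall>k::nat. k \<ge> 4 \<longrightarrow> (\<exists>\<beta>::real. R_hash k \<le> ereal \<beta> \<and> \<beta> < alpha_FK k))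
    \<and> (R_hash 5 < ereal 0.190825 \<and> (0.190825::real) < 0.192 \<and> alpha_FK 5 = 0.192)
    \<and> (R_hash 6 < ereal 0.0922787 \<and> (0.0922787::real) < 5/54 \<and> alpha_FK 6 = 5/54)"
proof (intro conjI allI impI)
  fix k :: nat assume k: "k \<ge> 4"
  define \<alpha> L where "\<alpha> = alpha_FK k" and "L = log 2 (real k)"
  \<comment> \<open>Any number strictly between \<alpha> \<open>/ (1 +\<close> \<alpha>
    \<open>/ L)\<close>, the fixed point of the new bound, and \<alpha> would do. This one is the
    new bound evaluated at \<alpha> \<open>/ 2\<close>; as \<beta> exceeds \<alpha>
    \<open>/ 2\<close>, the bound at \<beta> is smaller than \<beta>.\<close>
  define \<beta> where "\<beta> = \<alpha> * (1 - \<alpha> / (2 * L))"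
  have \<alpha>: "0 < \<alpha>" "\<alpha> \<le> 1" using k by (simp_all add: \<alpha>_def alpha_FK_pos alpha_FK_le_1)
  have L: "L > 1" using k by (simp add: L_def)
  have "\<alpha> / (2 * L) < 1 / 2" using \<alpha> L by (simp add: field_simps)
  then have "\<alpha> * (1 / 2) < \<beta>" unfolding \<beta>_def using \<alpha> by (intro mult_strict_left_mono) auto
  then have half: "\<alpha> / 2 < \<beta>" by simp
  have less: "\<beta> < \<alpha>" using \<alpha> L by (simp add: \<beta>_def)
  have "\<alpha> * (\<alpha> / 2) / L < \<alpha> * \<beta> / L" using half \<alpha> L by (intro divide_strict_right_mono mult_strict_left_mono) auto
  then have "\<alpha> * (1 - \<beta> / L) < \<beta>" by (subst (2) \<beta>_def) (simp add: right_diff_distrib)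
  moreover have "0 < \<beta>" "\<beta> \<le> L" using half less \<alpha> L by linarith+
  ultimately have "R_hash k \<le> ereal \<beta>"
    using k unfolding \<alpha>_def L_def by (intro R_hash_le)
  with less show "\<exists>\<beta>. R_hash k \<le> ereal \<beta> \<and> \<beta> < alpha_FK k" unfolding \<alpha>_def by blast
next
  show 5: "alpha_FK 5 = 0.192" and 6: "alpha_FK 6 = 5/54"
    by (simp_all add: alpha_FK_def fact_numeral)
  have "log 2 8 = (3::real)" using log_of_power_eq[of 8 2 3] by simp
  moreover have "log 2 (real 5) \<le> log 2 8" "log 2 (real 6) \<le> log 2 8" by simp_all
  ultimately have le3: "log 2 (real 5) \<le> 3" "log 2 (real 6) \<le> 3" by simp_all
  have ge1: "1 \<le> log 2 (real 5)" "1 \<le> log 2 (real 6)" by simp_all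
  \<comment> \<open>\<open>R_hash_le\<close> is not strict, so it is applied to a number slightly
    below the target. The crude estimate \<open>log 2 5 \<le> 3\<close> suffices, since
    \<open>0.192 * (1 - 0.19 / 3) < 0.18\<close>; the case \<open>k = 6\<close> is similar.\<close>
  have "R_hash 5 \<le> ereal 0.19"
  proof (rule R_hash_le)
    show "0.19 \<le> log 2 (real 5)" by (rule order.trans[OF _ ge1(1)]) simp
    have "0.192 * (1 - 0.19 / L) < 0.19" if "1 \<le> L" "L \<le> 3" for L :: real
      using that by (simp add: field_simps)
    from this[OF ge1(1) le3(1)] show "alpha_FK 5 * (1 - 0.19 / log 2 (real 5)) < 0.19"
      unfolding 5 .
  qed simp_all
  then show "R_hash 5 < ereal 0.190825" by (rule le_less_trans) simp
  have "R_hash 6 \<le> ereal 0.092"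
  proof (rule R_hash_le)
    show "0.092 \<le> log 2 (real 6)" by (rule order.trans[OF _ ge1(2)]) simp
    have "5 / 54 * (1 - 0.092 / L) < 0.092" if "1 \<le> L" "L \<le> 3" for L :: real
      using that by (simp add: field_simps)
    from this[OF ge1(2) le3(2)] show "alpha_FK 6 * (1 - 0.092 / log 2 (real 6)) < 0.092"
      unfolding 6 .
  qed simp_all
  then show "R_hash 6 < ereal 0.0922787" by (rule le_less_trans) simp
qed simp_all

end
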